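(* Let $M=(C_1,\ldots,C_n)$ be a uniform-cost stratified definite multi-context system (MCS) with $m$ bridge rules. Then the worst-case context-independent time complexity of deciding the consistency problem for $M$, as well as the reasoning problem w.r.t. $M$ for some query $p$, has the upper bound $$\mathrm{CTime}(n,m)\le n.$$ In the case $M$ is not a uniform-cost MCS, the worst-case cost-complexity of deciding the consistency problem for $M$, as well as the reasoning problem w.r.t. $M$ for some query $p$, has the upper bound $$\mathrm{Cost}(n,m)\le c\cdot\mathrm{CTime}(n,m)=c\cdot n,$$ where $c=\max_{i=1,\ldots,n}\mathrm{cost}(\mathsf{ACC}_i)$.
   Context: Logic suite: a tuple $L=(\mathsf{KB},\mathsf{BS},\mathsf{ACC},\mathrm{cost})$, where $\mathsf{KB}$ is the set of well-formed finite knowledge bases (each a finite set, $\emptyset\in\mathsf{KB}$), $\mathsf{BS}$ is the set of possible finite belief sets, $\mathsf{ACC}:\mathsf{KB}\to 2^{\mathsf{BS}}$ is a semantic operator which, given a knowledge base $kb$, returns a set of acceptable belief sets, each with cardinality polynomial in the size of $kb$, and $\mathrm{cost}:\mathsf{KB}\to\mathbb{R}^+$ assigns to each knowledge base the cost of a single execution of $\mathsf{ACC}$ over it. $\mathrm{cost}(\mathsf{ACC})=\max_{kb\in\mathsf{KB}}\mathrm{cost}(kb)$ is the maximal cost of an invocation of $\mathsf{ACC}$. $L$ is monotonic iff $\mathsf{ACC}(kb)$ is a singleton for every $kb\in\mathsf{KB}$, and $kb\subseteq kb'$, $\mathsf{ACC}(kb)=\{T\}$, $\mathsf{ACC}(kb')=\{T'\}$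 imply $T\subseteq T'$. Definite MCS: $M=(C_1,\ldots,C_n)$ with contexts $C_i=(L_i,br_i)$, where $L_i=(\mathsf{KB}_i,\mathsf{BS}_i,\mathsf{ACC}_i,\mathrm{cost}_i)$ is a monotonic logic suite and $br_i$ is a finite set of bridge rules without negation, i.e. of the form $s\leftarrow (c_1:p_1),\ldots,(c_j:p_j)$, where $c_k\in\{1,\ldots,n\}$, $p_k$ is an element of some belief set in $\mathsf{BS}_{c_k}$, and $kb\cup\{s\}\in\mathsf{KB}_i$ for every $kb\in\mathsf{KB}_i$. For such a rule $r$, $\mathrm{head}(r)=s$, and its body literals are $(c_1:p_1),\ldots,(c_j:p_j)$. The number of bridge rules is $m=\sum_{i=1}^n|br_i|$. Stratified: a stratification of a definite MCS $M$ is a decomposition $\mathfrak{S}_0,\ldots,\mathfrak{S}_q$ of its set of contexts $\{C_1,\ldots,C_n\}$ into pairwise disjoint subsets such that for each bridge rule $r\in br_i$ of a context $C_i\in\mathfrak{S}_k$, each body literal $(j:p)$ of $r$ corresponds to a context $C_j\in\mathfrak{S}_l$ with $l<k$. A definite MCS is stratified (acyclic) iff it has a stratification. Belief state: $S=(S_1,\ldots,S_n)$ with $S_i\in\mathsf{BS}_i$. A rule is satisfied in $S$ iff $p_k\in S_{c_k}$ for all its body literals $(c_k:p_k)$. $S$ is an equilibrium of $M$ iff for every $i$, $S_i\in\mathsf{ACC}_i(\{\mathrm{head}(r)\mid r\in br_i\text{ satisfied in }S\})$. The grounded equilibrium of a definite MCS is its unique set-inclusion (componentwise) minimal equilibrium.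 Problems: consistency is deciding whether $M$ has an equilibrium. $S$ entails a query $p$ iff $p\in S_i$ for some $i$. The reasoning problem is deciding whether the grounded equilibrium of $M$ entails $p$ (brave reasoning, i.e. some equilibrium entails $p$, and cautious reasoning, i.e. all equilibria entail $p$, are treated as coinciding for definite MCSs). Complexity measures: the contexts are opaque, and a deterministic algorithm $\mathcal{A}$ taking an MCS $M$ as input employs the semantic operators of the contexts by invoking them on knowledge bases. If $\mathcal{A}$ on $M$ performs the series of invocations $\mathsf{ACC}_{c_1},\ldots,\mathsf{ACC}_{c_t}$, then $\mathrm{Cost}_{\mathcal{A}}(M)=\sum_{k=1}^{t}\mathrm{cost}(\mathsf{ACC}_{c_k})$. The worst-case cost-complexity $\mathrm{Cost}_{\mathcal{A}}(n,m)$ is the maximum of $\mathrm{Cost}_{\mathcal{A}}(M)$ over all MCSs $M$ (here: of the class considered, stratified definite MCSs) with precisely $n$ contexts and $m$ bridge rules. An MCS is uniform-cost iff $\mathrm{cost}(\mathsf{ACC}_i)=1$ for all $i$; the context-independent worst-case time complexity $\mathrm{CTime}_{\mathcal{A}}(n,m)$ is $\mathrm{Cost}_{\mathcal{A}}(n,m)$ taken over uniform-cost MCSs, i.e. the worst-case number of invocations of semantic operators. Without a subscript, $\mathrm{Cost}(n,m)$ and $\mathrm{CTime}(n,m)$ refer to the problem being decided: the minimum of $\mathrm{Cost}_{\mathcal{A}}(n,m)$, respectively $\mathrm{CTime}_{\mathcal{A}}(n,m)$, over the algorithms $\mathcal{A}$ deciding it.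
   Formalization: For consistency, c·CTime(n,m) = c·n is weakened to ≤, as an equilibrium always exists and so CTime(n,m) = 0; for reasoning the equality is proved. Cost(n,m) is taken over systems with maximal operator cost c; algorithms are decision trees charged only for invocations. *)

theory Defs
  imports
    "HOL-Library.Extended_Nonnegative_Real"
    "HOL-Library.Disjoint_Sets"
    "HOL-Computational_Algebra.Polynomial"
begin

section \<open>Logic suites\<close>

record ('f, 'b) logic_suite =
  KB :: "'f set set"
  BS :: "'b set set"
  ACC :: "'f set \<Rightarrow> 'b set set"
  cost :: "'f set \<Rightarrow> real"

text \<open>
  The values of \<open>ACC\<close> and \<open>cost\<close> outside \<open>KB\<close> are irrelevant. The size of a
  knowledge base is its cardinality; the bounding polynomial may depend on the logic suite.
\<close>

definition wf_logic_suite :: "('f, 'b) logic_suite \<Rightarrow> bool" where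
  "wf_logic_suite L \<longleftrightarrow>
     (\<forall>kb \<in> KB L. finite kb) \<and> {} \<in> KB L \<and>
     (\<forall>T \<in> BS L. finite T) \<and>
     (\<forall>kb \<in> KB L. ACC L kb \<subseteq> BS L) \<and>
     (\<exists>q :: nat poly. \<forall>kb \<in> KB L. \<forall>T \<in> ACC L kb. card T \<le> poly q (card kb)) \<and>
     (\<forall>kb \<in> KB L. cost L kb > 0)"

definition monotonic :: "('f, 'b) logic_suite \<Rightarrow> bool" where
  "monotonic L \<longleftrightarrow>
     (\<forall>kb \<in> KB L. \<exists>T. ACC L kb = {T}) \<and>
     (\<forall>kb \<in> KB L. \<forall>kb' \<in> KB L. \<forall>T T'.
        kb \<subseteq> kb' \<longrightarrow> ACC L kb = {T} \<longrightarrow> ACC L kb' = {T'} \<longrightarrow> T \<subseteq> T')"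

text \<open>The supremum is the maximum whenever the latter exists, and \<open>\<infinity>\<close> if costs are unbounded.\<close>

definition cost_ACC :: "('f, 'b) logic_suite \<Rightarrow> ennreal" where
  "cost_ACC L = (SUP kb \<in> KB L. ennreal (cost L kb))"


section \<open>Definite multi-context systems\<close>

text \<open>
  Contexts are numbered \<open>0, \<dots>, n - 1\<close>. A body literal \<open>(c : p)\<close> is the pair \<open>(c, p)\<close>.
  Heterogeneous contexts share the types \<open>'f\<close> of formulas and \<open>'b\<close> of beliefs;
  each logic suite selects its own fragment through \<open>KB\<close> and \<open>BS\<close>.
\<close>

datatype ('f, 'b) bridge_rule = Bridge_Rule (head: 'f) (body: "(nat \<times> 'b) list")

record ('f, 'b) mcs_context =
  logic :: "('f, 'b) logic_suite"
  br :: "('f, 'b) bridge_rule set"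

type_synonym ('f, 'b) mcs = "('f, 'b) mcs_context list"

definition definite_mcs :: "('f, 'b) mcs \<Rightarrow> bool" where
  "definite_mcs M \<longleftrightarrow> M \<noteq> [] \<and>
     (\<forall>C \<in> set M.
        wf_logic_suite (logic C) \<and> monotonic (logic C) \<and> finite (br C) \<and>
        (\<forall>r \<in> br C.
           (\<forall>(c, p) \<in> set (body r). c < length M \<and> (\<exists>T \<in> BS (logic (M ! c)). p \<in> T)) \<and>
           (\<forall>kb \<in> KB (logic C). kb \<union> {head r} \<in> KB (logic C))))"

definition num_bridge_rules :: "('f, 'b) mcs \<Rightarrow> nat" where
  "num_bridge_rules M = (\<Sum>i<length M. card (br (M ! i)))"

definition stratification :: "('f, 'b) mcs \<Rightarrow> nat set list \<Rightarrow> bool" where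
  "stratification M \<SS> \<longleftrightarrow>
     (\<Union>k<length \<SS>. \<SS> ! k) = {..<length M} \<and>
     disjoint_family_on (\<lambda>k. \<SS> ! k) {..<length \<SS>} \<and>
     (\<forall>k<length \<SS>. \<forall>i \<in> \<SS> ! k. \<forall>r \<in> br (M ! i). \<forall>(j, p) \<in> set (body r).
        \<exists>l<k. j \<in> \<SS> ! l)"

definition stratified :: "('f, 'b) mcs \<Rightarrow> bool" where
  "stratified M \<longleftrightarrow> (\<exists>\<SS>. stratification M \<SS>)"


section \<open>Equilibria and decision problems\<close>

type_synonym 'b belief_state = "'b set list"

definition belief_state :: "('f, 'b) mcs \<Rightarrow> 'b belief_state \<Rightarrow> bool" where
  "belief_state M S \<longleftrightarrow> length S = length M \<and> (\<forall>i<length M. S ! i \<in> BS (logic (M ! i)))"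

definition satisfied :: "'b belief_state \<Rightarrow> ('f, 'b) bridge_rule \<Rightarrow> bool" where
  "satisfied S r \<longleftrightarrow> (\<forall>(c, p) \<in> set (body r). p \<in> S ! c)"

definition equilibrium :: "('f, 'b) mcs \<Rightarrow> 'b belief_state \<Rightarrow> bool" where
  "equilibrium M S \<longleftrightarrow> belief_state M S \<and>
     (\<forall>i<length M. S ! i \<in> ACC (logic (M ! i)) {head r | r. r \<in> br (M ! i) \<and> satisfied S r})"

definition minimal_equilibrium :: "('f, 'b) mcs \<Rightarrow> 'b belief_state \<Rightarrow> bool" where
  "minimal_equilibrium M S \<longleftrightarrow> equilibrium M S \<and>
     (\<forall>S'. equilibrium M S' \<longrightarrow> list_all2 (\<subseteq>) S' S \<longrightarrow> S' = S)"

definition grounded_equilibrium :: "('f, 'b) mcs \<Rightarrow> 'b belief_state" where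
  "grounded_equilibrium M = (THE S. minimal_equilibrium M S)"

definition entails :: "'b belief_state \<Rightarrow> 'b \<Rightarrow> bool" where
  "entails S p \<longleftrightarrow> (\<exists>i<length S. p \<in> S ! i)"

definition consistency :: "('f, 'b) mcs \<Rightarrow> bool" where
  "consistency M \<longleftrightarrow> (\<exists>S. equilibrium M S)"

definition reasoning :: "'b \<Rightarrow> ('f, 'b) mcs \<Rightarrow> bool" where
  "reasoning p M \<longleftrightarrow> entails (grounded_equilibrium M) p"


section \<open>Algorithms with opaque contexts\<close>

text \<open>
  A deterministic algorithm reads the number of contexts and their bridge rules, that is,
  \<open>map br M\<close>. The logic suites are opaque: they are accessible only by invoking a semantic
  operator on a knowledge base, and the continuation may depend on the value returned.
  A computation is therefore an adaptive decision tree: \<open>Invoke i kb \<kappa>\<close> invokes the operator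
  of context \<open>i\<close> on \<open>kb\<close> and continues with \<open>\<kappa>\<close> applied to the value. As in any query model,
  only invocations are charged. Well-foundedness of the datatype ensures termination.
\<close>

datatype ('f, 'b) computation =
    Answer bool
  | Invoke nat "'f set" "'b set set \<Rightarrow> ('f, 'b) computation"

type_synonym ('f, 'b) algorithm = "('f, 'b) bridge_rule set list \<Rightarrow> ('f, 'b) computation"

primrec answer :: "('f, 'b) mcs \<Rightarrow> ('f, 'b) computation \<Rightarrow> bool" where
  "answer M (Answer b) = b"
| "answer M (Invoke i kb \<kappa>) = answer M (\<kappa> (ACC (logic (M ! i)) kb))"

primrec invocations :: "('f, 'b) mcs \<Rightarrow> ('f, 'b) computation \<Rightarrow> (nat \<times> 'f set) list" where
  "invocations M (Answer b) = []"
| "invocations M (Invoke i kb \<kappa>) = (i, kb) # invocations M (\<kappa> (ACC (logic (M ! i)) kb))"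

text \<open>Semantic operators may only be invoked on well-formed knowledge bases.\<close>

definition decides :: "('f, 'b) algorithm \<Rightarrow> (('f, 'b) mcs \<Rightarrow> bool) \<Rightarrow> bool" where
  "decides A P \<longleftrightarrow> (\<forall>M. definite_mcs M \<longrightarrow> stratified M \<longrightarrow>
     (\<forall>(i, kb) \<in> set (invocations M (A (map br M))). i < length M \<and> kb \<in> KB (logic (M ! i))) \<and>
     answer M (A (map br M)) = P M)"


section \<open>Complexity measures\<close>

definition alg_cost :: "('f, 'b) algorithm \<Rightarrow> ('f, 'b) mcs \<Rightarrow> ennreal" where
  "alg_cost A M = (\<Sum>(i, kb) \<leftarrow> invocations M (A (map br M)). cost_ACC (logic (M ! i)))"

text \<open>
  The worst case ranges over the stratified definite systems in \<open>K\<close> with precisely \<open>n\<close>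
  contexts and \<open>m\<close> bridge rules. The lattice operations of \<open>ennreal\<close> render maximum and
  minimum, as an algorithm may have unbounded worst-case cost.
\<close>

definition worst_case_cost ::
  "('f, 'b) algorithm \<Rightarrow> ('f, 'b) mcs set \<Rightarrow> nat \<Rightarrow> nat \<Rightarrow> ennreal" where
  "worst_case_cost A K n m =
     (SUP M \<in> {M \<in> K. definite_mcs M \<and> stratified M \<and> length M = n \<and> num_bridge_rules M = m}.
        alg_cost A M)"

definition problem_cost ::
  "(('f, 'b) mcs \<Rightarrow> bool) \<Rightarrow> ('f, 'b) mcs set \<Rightarrow> nat \<Rightarrow> nat \<Rightarrow> ennreal" where
  "problem_cost P K n m = (INF A \<in> {A. decides A P}. worst_case_cost A K n m)"

definition uniform_cost :: "('f, 'b) mcs \<Rightarrow> bool" where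
  "uniform_cost M \<longleftrightarrow> (\<forall>i<length M. cost_ACC (logic (M ! i)) = 1)"

definition max_cost :: "('f, 'b) mcs \<Rightarrow> ennreal" where
  "max_cost M = (MAX i \<in> {..<length M}. cost_ACC (logic (M ! i)))"

definition CTime :: "(('f, 'b) mcs \<Rightarrow> bool) \<Rightarrow> nat \<Rightarrow> nat \<Rightarrow> ennreal" where
  "CTime P n m = problem_cost P {M. uniform_cost M} n m"

text \<open>
  Over systems of arbitrary operator cost the worst case would be infinite; a bound in terms of
  the maximal operator cost \<open>c\<close> concerns the systems for which this maximum is \<open>c\<close>.
\<close>

definition Cost :: "(('f, 'b) mcs \<Rightarrow> bool) \<Rightarrow> ennreal \<Rightarrow> nat \<Rightarrow> nat \<Rightarrow> ennreal" where
  "Cost P c n m = problem_cost P {M. max_cost M = c} n m"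

end

theory Submission
  imports Defs
begin

text \<open>
  Evaluating the contexts along a topological order of the stratification invokes every operator
  exactly once and yields the unique equilibrium; this is the upper bound \<open>n\<close>. Consistency is
  trivial, as an equilibrium always exists. Conversely, replace the logic of every context by one
  whose operator always returns the empty belief set. An algorithm deciding \<open>reasoning p\<close> that
  does not invoke some context on this system cannot notice that its operator is replaced
  by the one always returning \<open>{p}\<close>, though this changes the correct answer. Hence all \<open>n\<close> contexts
  have to be invoked, and \<open>CTime\<close> of the reasoning problem equals \<open>n\<close>.
\<close>

section \<open>Evaluation orders\<close>

definition refs :: "('f, 'b) bridge_rule set \<Rightarrow> nat set" where
  "refs R = (\<Union>r\<in>R. fst ` set (body r))"

definition heads :: "('f, 'b) bridge_rule set \<Rightarrow> 'b belief_state \<Rightarrow> 'f set" where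
  "heads R S = {head r | r. r \<in> R \<and> satisfied S r}"

text \<open>A context sees the state only through the contexts its rules refer to. This locality is
  what lets a single pass suffice.\<close>

lemma heads_cong:
  assumes "\<And>j. j \<in> refs R \<Longrightarrow> S ! j = S' ! j"
  shows "heads R S = heads R S'"
proof -
  have "satisfied S r = satisfied S' r" if "r \<in> R" for r
  proof -
    have "S ! fst l = S' ! fst l" if "l \<in> set (body r)" for l
      using assms \<open>r \<in> R\<close> that by (auto simp: refs_def)
    then show ?thesis
      by (auto simp: satisfied_def split_beta)
  qed
  then show ?thesis
    by (auto simp: heads_def)
qed

text \<open>Topologically ordered lists, not necessarily exhaustive. Coverage is left to
  \<open>evaluation_order\<close>, so that this property passes to initial segments and supports
  induction from the right.\<close>

definition admissible :: "('f, 'b) bridge_rule set list \<Rightarrow> nat list \<Rightarrow> bool" where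
  "admissible bs xs \<longleftrightarrow> distinct xs \<and> (\<forall>ys i zs. xs = ys @ i # zs \<longrightarrow> refs (bs ! i) \<subseteq> set ys)"

definition evaluation_order :: "('f, 'b) bridge_rule set list \<Rightarrow> nat list \<Rightarrow> bool" where
  "evaluation_order bs xs \<longleftrightarrow> admissible bs xs \<and> set xs = {..<length bs}"

lemma admissible_snocD:
  assumes "admissible bs (xs @ [i])"
  shows "admissible bs xs" "i \<notin> set xs" "refs (bs ! i) \<subseteq> set xs"
  using assms unfolding admissible_def by auto

lemma admissible_refs:
  assumes "admissible bs xs" "i \<in> set xs"
  shows "refs (bs ! i) \<subseteq> set xs"
  using assms unfolding admissible_def by (metis Un_iff set_append split_list subset_iff)

text \<open>Sorting by stratum works because body literals point to strictly lower strata; the order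
  within a stratum is immaterial.\<close>

lemma stratified_evaluation_order:
  assumes "stratified M"
  shows "\<exists>xs. evaluation_order (map br M) xs"
proof -
  obtain \<SS> where \<SS>: "stratification M \<SS>"
    using assms by (auto simp: stratified_def)
  define lev where "lev i = (LEAST k. k < length \<SS> \<and> i \<in> \<SS> ! k)" for i
  define xs where "xs = sort_key lev [0..<length M]"
  have lev: "lev i < length \<SS> \<and> i \<in> \<SS> ! lev i" if "i < length M" for i
  proof -
    have "\<exists>k. k < length \<SS> \<and> i \<in> \<SS> ! k"
      using \<SS> that unfolding stratification_def by blast
    then show ?thesis
      unfolding lev_def by (rule LeastI_ex)
  qed
  have lower: "j < length M \<and> lev j < lev i"
    if i: "i < length M" and j: "j \<in> refs (br (M ! i))" for i j
  proof -
    from j obtain r q where rq: "r \<in> br (M ! i)" "(j, q) \<in> set (body r)"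
      by (auto simp: refs_def)
    have "\<forall>(j, q)\<in>set (body r). \<exists>k<lev i. j \<in> \<SS> ! k"
      using \<SS> lev[OF i] rq(1) unfolding stratification_def by blast
    then obtain k where k: "k < lev i" "j \<in> \<SS> ! k"
      using rq(2) by blast
    then have "k < length \<SS>"
      using lev[OF i] by simp
    then have "lev j \<le> k"
      unfolding lev_def using k by (intro Least_le) simp
    moreover have "j \<in> (\<Union>k<length \<SS>. \<SS> ! k)"
      using k \<open>k < length \<SS>\<close> by blast
    then have "j < length M"
      using \<SS> unfolding stratification_def by blast
    ultimately show ?thesis
      using k(1) by simp
  qed
  have "refs (map br M ! i) \<subseteq> set ys" if "xs = ys @ i # zs" for ys i zs
  proof
    have set_xs: "set xs = {..<length M}"
      by (auto simp: xs_def)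
    then have i: "i < length M"
      using that by auto
    fix j assume "j \<in> refs (map br M ! i)"
    then have j: "j < length M" "lev j < lev i"
      using lower i by auto
    have "sorted (map lev xs)"
      by (simp add: xs_def)
    \<comment> \<open>From \<open>i\<close> on, levels are at least \<open>lev i\<close>, so
      \<open>j\<close> with its smaller level can only lie in \<open>ys\<close>.\<close>
    then have "\<forall>k\<in>set (i # zs). lev i \<le> lev k"
      using that by (auto simp: sorted_append)
    then show "j \<in> set ys"
      using j set_xs that by fastforce
  qed
  then have "evaluation_order (map br M) xs"
    by (auto simp: evaluation_order_def admissible_def xs_def)
  then show ?thesis ..
qed

section \<open>Equilibria of stratified definite systems\<close>

lemma heads_in_KB:
  assumes "definite_mcs M" "i < length M"
  shows "heads (br (M ! i)) S \<in> KB (logic (M ! i))"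
proof -
  have C: "M ! i \<in> set M"
    using assms by simp
  have fin: "finite (br (M ! i))" and empty: "{} \<in> KB (logic (M ! i))"
    and closed: "\<And>r kb. r \<in> br (M ! i) \<Longrightarrow> kb \<in> KB (logic (M ! i)) \<Longrightarrow>
      insert (head r) kb \<in> KB (logic (M ! i))"
    using assms(1) C by (auto simp: definite_mcs_def wf_logic_suite_def)
  \<comment> \<open>Generalised from the satisfied rules to any finite set of rules, so that heads
    can be added one at a time, starting from \<open>{}\<close>.\<close>
  have "head ` R \<in> KB (logic (M ! i))" if "finite R" "R \<subseteq> br (M ! i)" for R
    using that by (induction R rule: finite_induct) (auto intro: empty closed)
  moreover have "heads (br (M ! i)) S = head ` {r \<in> br (M ! i). satisfied S r}"
    by (auto simp: heads_def)
  ultimately show ?thesis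
    using fin by simp
qed

lemma definite_ACC_singleton:
  assumes "definite_mcs M" "i < length M" "kb \<in> KB (logic (M ! i))"
  obtains T where "ACC (logic (M ! i)) kb = {T}" "T \<in> BS (logic (M ! i))"
proof -
  have C: "M ! i \<in> set M"
    using assms by simp
  obtain T where T: "ACC (logic (M ! i)) kb = {T}"
    using assms(1,3) C by (force simp: definite_mcs_def monotonic_def)
  have "ACC (logic (M ! i)) kb \<subseteq> BS (logic (M ! i))"
    using assms(1,3) C by (auto simp: definite_mcs_def wf_logic_suite_def)
  then show thesis
    using that T by simp
qed

section \<open>Evaluation along an order\<close>

definition step :: "('f, 'b) mcs \<Rightarrow> nat \<Rightarrow> 'b belief_state \<Rightarrow> 'b belief_state" where
  "step M i S = S[i := the_elem (ACC (logic (M ! i)) (heads (br (M ! i)) S))]"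

lemma length_fold_step [simp]: "length (fold (step M) xs S) = length S"
  by (induction xs arbitrary: S) (auto simp: step_def)

text \<open>The entry at \<open>i\<close> is computed in an intermediate state. Later steps
  overwrite neither it nor the entries its rules read, so the equation persists in the final
  state.\<close>

lemma fold_step_nth:
  assumes "admissible (map br M) xs" "set xs \<subseteq> {..<length M}" "length S = length M" "i \<in> set xs"
  shows "fold (step M) xs S ! i =
    the_elem (ACC (logic (M ! i)) (heads (br (M ! i)) (fold (step M) xs S)))"
  using assms
proof (induction xs arbitrary: i rule: rev_induct)
  case Nil
  then show ?case by simp
next
  case (snoc k xs)
  let ?T = "fold (step M) xs S" and ?T' = "fold (step M) (xs @ [k]) S"
  note adm = admissible_snocD[OF snoc.prems(1)]
  have k: "k < length M"
    using snoc.prems by auto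
  have agree: "?T' ! j = ?T ! j" if "j \<in> set xs" for j
  proof -
    have "k \<noteq> j" using adm(2) that by blast
    then show ?thesis by (simp add: step_def)
  qed
  \<comment> \<open>Whether \<open>i\<close> is \<open>k\<close> or an earlier entry, its references
    lie in \<open>xs\<close>, where the last step changes nothing.\<close>
  have heads: "heads (br (M ! i)) ?T' = heads (br (M ! i)) ?T"
  proof (rule heads_cong, rule agree)
    fix j assume "j \<in> refs (br (M ! i))"
    moreover have "refs (map br M ! i) \<subseteq> set xs"
      using snoc.prems(4) adm admissible_refs[OF adm(1)] by auto
    moreover have "i < length M"
      using snoc.prems by auto
    ultimately show "j \<in> set xs" by auto
  qed
  show ?case
  proof (cases "i = k")
    case True
    have "?T' ! k = the_elem (ACC (logic (M ! k)) (heads (br (M ! k)) ?T))"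
      using k snoc.prems(3) by (simp add: step_def)
    then show ?thesis
      using heads True by simp
  next
    case False
    then have "i \<in> set xs"
      using snoc.prems by auto
    then show ?thesis
      using snoc.IH[of i] snoc.prems adm(1) agree heads by simp
  qed
qed

lemma equilibrium_fold_step:
  assumes "definite_mcs M" "evaluation_order (map br M) xs" "length S = length M"
  shows "equilibrium M (fold (step M) xs S)"
proof -
  let ?T = "fold (step M) xs S"
  have nth: "?T ! i = the_elem (ACC (logic (M ! i)) (heads (br (M ! i)) ?T))"
    if "i < length M" for i
    using fold_step_nth[of M xs S i] assms that by (auto simp: evaluation_order_def)
  have "?T ! i \<in> BS (logic (M ! i)) \<and> ?T ! i \<in> ACC (logic (M ! i)) (heads (br (M ! i)) ?T)"
    if i: "i < length M" for i
  proof -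
    obtain U where U: "ACC (logic (M ! i)) (heads (br (M ! i)) ?T) = {U}" "U \<in> BS (logic (M ! i))"
      using definite_ACC_singleton[OF assms(1) i heads_in_KB[OF assms(1) i]] .
    then have "?T ! i = U"
      using nth[OF i] by simp
    with U show ?thesis by simp
  qed
  then show ?thesis
    using assms(3) by (auto simp: equilibrium_def belief_state_def heads_def)
qed

text \<open>Agreement spreads along the order: equal beliefs at the referenced contexts give equal
  heads, and a singleton operator value leaves no choice.\<close>

lemma equilibrium_unique:
  assumes "definite_mcs M" "stratified M" "equilibrium M S" "equilibrium M S'"
  shows "S = S'"
proof -
  obtain xs where xs: "admissible (map br M) xs" "set xs = {..<length M}"
    using stratified_evaluation_order[OF assms(2)] by (auto simp: evaluation_order_def)
  have "\<forall>i\<in>set ys. S ! i = S' ! i" if "admissible (map br M) ys" "set ys \<subseteq> {..<length M}" for ys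
    using that
  proof (induction ys rule: rev_induct)
    case Nil
    then show ?case by simp
  next
    case (snoc k ys)
    note adm = admissible_snocD[OF snoc.prems(1)]
    have k: "k < length M"
      using snoc.prems by auto
    have IH: "\<forall>i\<in>set ys. S ! i = S' ! i"
      using snoc.IH adm(1) snoc.prems(2) by simp
    have "heads (br (M ! k)) S = heads (br (M ! k)) S'"
      using IH adm(3) k by (intro heads_cong) auto
    moreover have "S ! k \<in> ACC (logic (M ! k)) (heads (br (M ! k)) S)"
      "S' ! k \<in> ACC (logic (M ! k)) (heads (br (M ! k)) S')"
      using assms(3,4) k by (auto simp: equilibrium_def heads_def)
    moreover obtain T where "ACC (logic (M ! k)) (heads (br (M ! k)) S) = {T}"
      using definite_ACC_singleton[OF assms(1) k heads_in_KB[OF assms(1) k]] .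
    ultimately have "S ! k = S' ! k"
      by simp
    then show ?case
      using IH by simp
  qed
  then show ?thesis
    using xs assms(3,4)
    by (intro nth_equalityI) (auto simp: equilibrium_def belief_state_def)
qed

lemma stratified_consistency:
  assumes "definite_mcs M" "stratified M"
  shows "consistency M"
  using stratified_evaluation_order[OF assms(2)] equilibrium_fold_step[OF assms(1)]
  by (metis consistency_def length_replicate)

text \<open>By uniqueness \<open>THE\<close> denotes \<open>S\<close>, so any equilibrium, however
  obtained, answers the query.\<close>

lemma reasoning_iff_entails:
  assumes "definite_mcs M" "stratified M" "equilibrium M S"
  shows "reasoning p M \<longleftrightarrow> entails S p"
proof -
  have "minimal_equilibrium M S' \<longleftrightarrow> S' = S" for S'
    using equilibrium_unique[OF assms(1,2)] assms(3) unfolding minimal_equilibrium_def by blast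
  then show ?thesis
    by (simp add: reasoning_def grounded_equilibrium_def)
qed

section \<open>Upper bound\<close>

text \<open>The computation counterpart of \<open>fold (step M)\<close>: it sees only the bridge
  rules, and the returned \<open>V\<close> replaces direct access to \<open>ACC\<close>.\<close>

primrec evaluate ::
  "'b \<Rightarrow> ('f, 'b) bridge_rule set list \<Rightarrow> nat list \<Rightarrow> 'b belief_state \<Rightarrow> ('f, 'b) computation"
where
  "evaluate p bs [] S = Answer (entails S p)"
| "evaluate p bs (i # is) S =
     Invoke i (heads (bs ! i) S) (\<lambda>V. evaluate p bs is (S[i := the_elem V]))"

text \<open>The order is chosen from the bridge rules alone, which an algorithm may inspect free of
  charge. The initial empty sets are placeholders, all overwritten when the order covers every
  context.\<close>

definition reasoner :: "'b \<Rightarrow> ('f, 'b) algorithm" where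
  "reasoner p bs = evaluate p bs (SOME xs. evaluation_order bs xs) (replicate (length bs) {})"

lemma answer_evaluate:
  assumes "set xs \<subseteq> {..<length M}"
  shows "answer M (evaluate p (map br M) xs S) = entails (fold (step M) xs S) p"
  using assms by (induction xs arbitrary: S) (auto simp: step_def)

text \<open>The returned values influence the knowledge bases but never which context comes next, so
  the cost is fixed by the order alone.\<close>

lemma map_fst_invocations_evaluate:
  "map fst (invocations M (evaluate p bs xs S)) = xs"
  by (induction xs arbitrary: S) auto

lemma invocations_evaluate_wf:
  assumes "definite_mcs M" "set xs \<subseteq> {..<length M}"
    and "(i, kb) \<in> set (invocations M (evaluate p (map br M) xs S))"
  shows "i < length M \<and> kb \<in> KB (logic (M ! i))"
  using assms(2,3)
  by (induction xs arbitrary: S) (auto simp: heads_in_KB[OF assms(1)])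

lemma reasoner_eq_evaluate:
  assumes "stratified M"
  obtains xs where "evaluation_order (map br M) xs"
    and "reasoner p (map br M) = evaluate p (map br M) xs (replicate (length M) {})"
  using someI_ex[OF stratified_evaluation_order[OF assms]] by (auto simp: reasoner_def)

lemma decides_reasoner: "decides (reasoner p) (reasoning p)"
  unfolding decides_def
proof (intro allI impI)
  fix M :: "('f, 'b) mcs"
  assume M: "definite_mcs M" "stratified M"
  obtain xs where xs: "evaluation_order (map br M) xs"
    and eq: "reasoner p (map br M) = evaluate p (map br M) xs (replicate (length M) {})"
    using reasoner_eq_evaluate[OF M(2)] .
  have sub: "set xs \<subseteq> {..<length M}"
    using xs by (simp add: evaluation_order_def)
  show "(\<forall>(i, kb)\<in>set (invocations M (reasoner p (map br M))).
      i < length M \<and> kb \<in> KB (logic (M ! i))) \<and>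
    answer M (reasoner p (map br M)) = reasoning p M"
    using invocations_evaluate_wf[OF M(1) sub]
      reasoning_iff_entails[OF M equilibrium_fold_step[OF M(1) xs length_replicate]]
    by (auto simp: eq answer_evaluate[OF sub])
qed

lemma alg_cost_eq_sum_list:
  "alg_cost A M =
    (\<Sum>i\<leftarrow>map fst (invocations M (A (map br M))). cost_ACC (logic (M ! i)))"
  by (simp add: alg_cost_def comp_def case_prod_unfold)

lemma alg_cost_reasoner:
  assumes "stratified M"
  shows "alg_cost (reasoner p) M = (\<Sum>i<length M. cost_ACC (logic (M ! i)))"
proof -
  obtain xs where xs: "evaluation_order (map br M) xs"
    and eq: "reasoner p (map br M) = evaluate p (map br M) xs (replicate (length M) {})"
    using reasoner_eq_evaluate[OF assms] .
  then show ?thesis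
    \<comment> \<open>Distinctness of the order turns the sum over invocations into one over
      contexts.\<close>
    using sum_list_distinct_conv_sum_set[of xs "\<lambda>i. cost_ACC (logic (M ! i))"]
    by (simp add: alg_cost_eq_sum_list eq map_fst_invocations_evaluate
        evaluation_order_def admissible_def del: map_map)
qed

text \<open>Serves both measures: \<open>c = 1\<close> for uniform-cost systems, and the maximal
  operator cost for \<open>Cost\<close>.\<close>

lemma problem_cost_reasoning_le:
  assumes "\<And>M i. M \<in> K \<Longrightarrow> i < length M \<Longrightarrow> cost_ACC (logic (M ! i)) \<le> c"
  shows "problem_cost (reasoning p) K n m \<le> c * of_nat n"
  unfolding problem_cost_def
proof (rule INF_lower2)
  show "reasoner p \<in> {A. decides A (reasoning p)}"
    by (simp add: decides_reasoner)
  show "worst_case_cost (reasoner p) K n m \<le> c * of_nat n"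
    unfolding worst_case_cost_def
  proof (rule SUP_least, clarify)
    fix M assume M: "M \<in> K" "stratified M"
    have "(\<Sum>i<length M. cost_ACC (logic (M ! i))) \<le> (\<Sum>i<length M. c)"
      using assms[OF M(1)] by (intro sum_mono) auto
    then show "alg_cost (reasoner p) M \<le> c * of_nat (length M)"
      by (simp add: alg_cost_reasoner[OF M(2)] mult.commute)
  qed
qed

text \<open>Since an equilibrium always exists, the algorithm answering \<open>True\<close> without
  any invocation is correct.\<close>

lemma problem_cost_consistency: "problem_cost consistency K n m = 0"
proof -
  have "decides (\<lambda>_. Answer True) consistency"
    by (auto simp: decides_def stratified_consistency)
  then have "problem_cost consistency K n m \<le> worst_case_cost (\<lambda>_. Answer True) K n m"
    unfolding problem_cost_def by (intro INF_lower) simp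
  also have "\<dots> \<le> 0"
    unfolding worst_case_cost_def by (intro SUP_least) (simp add: alg_cost_def)
  finally show ?thesis by simp
qed

section \<open>Lower bound\<close>

text \<open>\<open>KB\<close> and \<open>BS\<close> are as large as finiteness permits, so that
  every head and every body belief remains legal.\<close>

definition const_suite :: "'b set \<Rightarrow> ('f, 'b) logic_suite" where
  "const_suite T =
    \<lparr>KB = {kb. finite kb}, BS = {T. finite T}, ACC = (\<lambda>_. {T}), cost = (\<lambda>_. 1)\<rparr>"

text \<open>Keeping the bridge rules of \<open>M\<close> gives an algorithm the same input for every
  \<open>T\<close>; only the opaque part varies.\<close>

definition const_mcs :: "('f, 'b) mcs \<Rightarrow> (nat \<Rightarrow> 'b set) \<Rightarrow> ('f, 'b) mcs" where
  "const_mcs M T = map (\<lambda>i. \<lparr>logic = const_suite (T i), br = br (M ! i)\<rparr>) [0..<length M]"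

lemma length_const_mcs [simp]: "length (const_mcs M T) = length M"
  by (simp add: const_mcs_def)

lemma const_mcs_nth [simp]:
  "i < length M \<Longrightarrow> const_mcs M T ! i = \<lparr>logic = const_suite (T i), br = br (M ! i)\<rparr>"
  by (simp add: const_mcs_def)

lemma map_br_const_mcs [simp]: "map br (const_mcs M T) = map br M"
  by (rule nth_equalityI) auto

lemma num_bridge_rules_const_mcs [simp]: "num_bridge_rules (const_mcs M T) = num_bridge_rules M"
  by (simp add: num_bridge_rules_def)

lemma cost_ACC_const_suite [simp]: "cost_ACC (const_suite T :: ('f, 'b) logic_suite) = 1"
proof -
  have "(SUP kb\<in>{kb :: 'f set. finite kb}. 1) = (1 :: ennreal)"
    by (rule SUP_const) blast
  then show ?thesis
    by (simp add: cost_ACC_def const_suite_def)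
qed

lemma uniform_cost_const_mcs: "uniform_cost (const_mcs M T)"
  by (simp add: uniform_cost_def)

lemma wf_const_suite: "finite T \<Longrightarrow> wf_logic_suite (const_suite T)"
  \<comment> \<open>The constant polynomial \<open>card T\<close> bounds the only acceptable belief
    set.\<close>
  by (auto simp: wf_logic_suite_def const_suite_def intro!: exI[of _ "[:card T:]"])

lemma monotonic_const_suite: "monotonic (const_suite T)"
  by (auto simp: monotonic_def const_suite_def)

lemma definite_const_mcs:
  fixes M :: "('f, 'b) mcs"
  assumes "definite_mcs M" "\<And>i. finite (T i)"
  shows "definite_mcs (const_mcs M T)"
proof -
  have M: "finite (br (M ! i)) \<and> (\<forall>r\<in>br (M ! i). \<forall>(c, q)\<in>set (body r). c < length M)"
    if "i < length M" for i
    using bspec[OF conjunct2[OF assms(1)[unfolded definite_mcs_def]] nth_mem[OF that]]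
    by (simp add: case_prod_unfold)
  have BS: "\<exists>B\<in>BS (const_suite U :: ('f, 'b) logic_suite). q \<in> B" for q U
    by (rule bexI[of _ "{q}"]) (simp_all add: const_suite_def)
  have KB: "insert s kb \<in> KB (const_suite U :: ('f, 'b) logic_suite)"
    if "kb \<in> KB (const_suite U :: ('f, 'b) logic_suite)" for s kb U
    using that by (simp add: const_suite_def)
  have "M \<noteq> []"
    using assms(1) by (simp add: definite_mcs_def)
  then have nonempty: "const_mcs M T \<noteq> []"
    by (simp add: const_mcs_def)
  have "wf_logic_suite (logic C) \<and> monotonic (logic C) \<and> finite (br C) \<and>
    (\<forall>r\<in>br C. (\<forall>(c, q)\<in>set (body r). c < length (const_mcs M T) \<and>
        (\<exists>B\<in>BS (logic (const_mcs M T ! c)). q \<in> B)) \<and>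
      (\<forall>kb\<in>KB (logic C). kb \<union> {head r} \<in> KB (logic C)))"
    if C: "C \<in> set (const_mcs M T)" for C
  proof -
    obtain i where i: "i < length M" "C = \<lparr>logic = const_suite (T i), br = br (M ! i)\<rparr>"
      using C by (auto simp: const_mcs_def)
    have "\<forall>(c, q)\<in>set (body r). c < length (const_mcs M T) \<and>
        (\<exists>B\<in>BS (logic (const_mcs M T ! c)). q \<in> B)" if r: "r \<in> br (M ! i)" for r
    proof clarify
      fix c q assume "(c, q) \<in> set (body r)"
      then have "c < length M"
        using M[OF i(1)] r by blast
      then show "c < length (const_mcs M T) \<and> (\<exists>B\<in>BS (logic (const_mcs M T ! c)). q \<in> B)"
        using BS by simp
    qed
    then show ?thesis
      using M[OF i(1)] KB assms(2) by (simp add: i(2) wf_const_suite monotonic_const_suite)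
  qed
  then show ?thesis
    unfolding definite_mcs_def by (intro conjI[OF nonempty] ballI)
qed

lemma stratified_const_mcs:
  assumes "stratified M"
  shows "stratified (const_mcs M T)"
proof -
  obtain \<SS> where \<SS>: "stratification M \<SS>"
    using assms by (auto simp: stratified_def)
  then have "br (const_mcs M T ! i) = br (M ! i)" if "k < length \<SS>" "i \<in> \<SS> ! k" for i k
    \<comment> \<open>The index is in range because the strata contain only contexts of
      \<open>M\<close>.\<close>
    using that by (subst const_mcs_nth) (auto simp: stratification_def)
  then have "stratification (const_mcs M T) \<SS>"
    using \<SS> by (simp add: stratification_def)
  then show ?thesis
    by (auto simp: stratified_def)
qed

text \<open>The operators ignore their input, so the values \<open>T i\<close> form an equilibrium
  whatever the bridge rules are.\<close>

lemma reasoning_const_mcs: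
  assumes "definite_mcs M" "stratified M" "\<And>i. finite (T i)"
  shows "reasoning p (const_mcs M T) \<longleftrightarrow> (\<exists>i<length M. p \<in> T i)"
proof -
  have "equilibrium (const_mcs M T) (map T [0..<length M])"
    using assms(3) by (simp add: equilibrium_def belief_state_def const_suite_def)
  then show ?thesis
    using reasoning_iff_entails[OF definite_const_mcs[OF assms(1)] stratified_const_mcs[OF assms(2)]]
      assms(3)
    by (auto simp: entails_def)
qed

text \<open>For a fixed computation, a run depends on the system only through the operators it
  invokes. This is the indistinguishability behind the lower bound.\<close>

lemma answer_cong:
  assumes "\<And>i kb. (i, kb) \<in> set (invocations M C) \<Longrightarrow> logic (M ! i) = logic (M' ! i)"
  shows "answer M C = answer M' C"
  using assms
proof (induction C)
  case (Answer b)
  then show ?case by simp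
next
  case (Invoke i kb \<kappa>)
  have "logic (M ! i) = logic (M' ! i)"
    using Invoke.prems[of i kb] by simp
  moreover have "answer M (\<kappa> V) = answer M' (\<kappa> V)" if "V = ACC (logic (M ! i)) kb" for V
    using Invoke.prems that by (intro Invoke.IH) auto
  ultimately show ?case by simp
qed

lemma le_alg_cost_const_mcs:
  assumes "definite_mcs M" "stratified M" "decides A (reasoning p)"
  shows "of_nat (length M) \<le> alg_cost A (const_mcs M (\<lambda>_. {}))"
proof -
  let ?M = "const_mcs M (\<lambda>_. {})"
  let ?inv = "invocations ?M (A (map br M))"
  note decided = assms(3)[unfolded decides_def, rule_format,
      OF definite_const_mcs[OF assms(1)] stratified_const_mcs[OF assms(2)]]
  have bounded: "i < length M" if "(i, kb) \<in> set ?inv" for i kb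
    using decided[of "\<lambda>_. {}"] that by auto
  have "{..<length M} \<subseteq> fst ` set ?inv"
  proof (rule subsetI, rule ccontr)
    fix i assume i: "i \<in> {..<length M}" "i \<notin> fst ` set ?inv"
    \<comment> \<open>Changing only the context \<open>i\<close> that is never invoked turns the
      correct answer from \<open>False\<close> to \<open>True\<close>.\<close>
    let ?T = "(\<lambda>_. {})(i := {p})"
    have fin: "finite (?T j)" for j by simp
    have "answer ?M (A (map br M)) = answer (const_mcs M ?T) (A (map br M))"
    proof (rule answer_cong)
      fix j kb assume "(j, kb) \<in> set ?inv"
      then have "j \<noteq> i" "j < length M"
        using i(2) bounded by force+
      then show "logic (?M ! j) = logic (const_mcs M ?T ! j)" by simp
    qed
    then have "reasoning p ?M = reasoning p (const_mcs M ?T)"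
      using decided[of "\<lambda>_. {}"] decided[of ?T] fin by simp
    then show False
      using i(1) reasoning_const_mcs[OF assms(1,2), of ?T p]
        reasoning_const_mcs[OF assms(1,2), of "\<lambda>_. {}" p] by auto
  qed
  \<comment> \<open>Distinct invoked contexts are counted; repeated invocations only lengthen
    \<open>?inv\<close>, and each entry costs 1.\<close>
  then have "length M \<le> card (fst ` set ?inv)"
    using card_mono[of "fst ` set ?inv" "{..<length M}"] by simp
  also have "\<dots> \<le> length ?inv"
    by (metis card_length length_map set_map)
  finally have "length M \<le> length ?inv" .
  moreover have "alg_cost A ?M = (\<Sum>_\<leftarrow>?inv. 1)"
    unfolding alg_cost_def using bounded
    by (intro arg_cong[where f = sum_list]) auto
  moreover have "(\<Sum>_\<leftarrow>?inv. 1 :: ennreal) = of_nat (length ?inv)"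
    by (simp add: sum_list_triv)
  ultimately show ?thesis
    by simp
qed

text \<open>The given \<open>M\<close> witnesses that the class for its \<open>n\<close> and
  \<open>m\<close> is nonempty: its constant variant is a uniform-cost system of the same dimensions
  on which every correct algorithm pays at least \<open>n\<close>.\<close>

lemma CTime_reasoning:
  fixes M :: "('f, 'b) mcs"
  assumes "definite_mcs M" "stratified M"
  shows "CTime (reasoning p :: ('f, 'b) mcs \<Rightarrow> bool) (length M) (num_bridge_rules M) =
    of_nat (length M)"
proof (rule antisym)
  show "CTime (reasoning p :: ('f, 'b) mcs \<Rightarrow> bool) (length M) (num_bridge_rules M)
      \<le> of_nat (length M)"
    using problem_cost_reasoning_le[of "{M :: ('f, 'b) mcs. uniform_cost M}" 1]
    by (simp add: CTime_def uniform_cost_def)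
  show "of_nat (length M)
      \<le> CTime (reasoning p :: ('f, 'b) mcs \<Rightarrow> bool) (length M) (num_bridge_rules M)"
    unfolding CTime_def problem_cost_def
  proof (rule INF_greatest)
    fix A :: "('f, 'b) algorithm"
    assume "A \<in> {A. decides A (reasoning p)}"
    then have "of_nat (length M) \<le> alg_cost A (const_mcs M (\<lambda>_. {}))"
      using le_alg_cost_const_mcs[OF assms] by simp
    also have "\<dots> \<le> worst_case_cost A {M. uniform_cost M} (length M) (num_bridge_rules M)"
      unfolding worst_case_cost_def
      by (rule SUP_upper)
        (simp add: uniform_cost_const_mcs definite_const_mcs stratified_const_mcs assms)
    finally show "of_nat (length M)
      \<le> worst_case_cost A {M. uniform_cost M} (length M) (num_bridge_rules M)" .
  qed
qed

section \<open>Cost-complexity and the combined bounds\<close>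

lemma Cost_reasoning_le: "Cost (reasoning p) c n m \<le> c * of_nat n"
  unfolding Cost_def
  by (rule problem_cost_reasoning_le) (auto simp: max_cost_def intro!: Max_ge)

theorem proposition24:
  fixes M :: "('f, 'b) mcs" and p :: 'b and n m :: nat and c :: ennreal
  assumes "definite_mcs M" and "stratified M"
    and "n = length M" and "m = num_bridge_rules M" and "c = max_cost M"
  shows "CTime (consistency :: ('f, 'b) mcs \<Rightarrow> bool) n m \<le> of_nat n \<and>
         CTime (reasoning p :: ('f, 'b) mcs \<Rightarrow> bool) n m \<le> of_nat n \<and>
         Cost (consistency :: ('f, 'b) mcs \<Rightarrow> bool) c n m
           \<le> c * CTime (consistency :: ('f, 'b) mcs \<Rightarrow> bool) n m \<and>
         c * CTime (consistency :: ('f, 'b) mcs \<Rightarrow> bool) n m \<le> c * of_nat n \<and>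
         Cost (reasoning p :: ('f, 'b) mcs \<Rightarrow> bool) c n m
           \<le> c * CTime (reasoning p :: ('f, 'b) mcs \<Rightarrow> bool) n m \<and>
         c * CTime (reasoning p :: ('f, 'b) mcs \<Rightarrow> bool) n m = c * of_nat n"
  \<comment> \<open>The exact value of \<open>CTime\<close> for reasoning gives the equality
    \<open>c * CTime = c * n\<close> and lets the cost bound be read against it. For consistency
    both measures are 0, hence only inequalities there.\<close>
  unfolding assms(3,4) CTime_reasoning[OF assms(1,2)]
  by (simp add: CTime_def Cost_def problem_cost_consistency
      Cost_reasoning_le[unfolded Cost_def])

end
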